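(* Let $\mu>-1/2$ and let $n\ge 0$ be an integer. For $\operatorname{Re}s>0$ the Mellin transforms $M_n^\mu(s)$ defined in the context are given by $$M_{2n}^\mu(s)=(-1)^n2^{2n}2^{(\mu+s)/2-1}\left(\mu+\tfrac12\right)_n\Gamma\left(\tfrac{\mu+s}{2}\right)\,{}_2F_1\left(-n,\tfrac{\mu+s}{2};\mu+\tfrac12;2\right),$$ and $$M_{2n+1}^\mu(s)=(-1)^n2^{2n}2^{(\mu+s+1)/2}\left(\mu+\tfrac32\right)_n\Gamma\left(\tfrac{\mu+s+1}{2}\right)\,{}_2F_1\left(-n,\tfrac{\mu+s+1}{2};\mu+\tfrac32;2\right).$$
   Context: Generalized Hermite polynomials, for $\mu>-1/2$: $H_{2n}^\mu(x)=(-1)^n2^{2n}n!\,L_n^{\mu-1/2}(x^2)$ and $H_{2n+1}^\mu(x)=(-1)^n2^{2n+1}n!\,x\,L_n^{\mu+1/2}(x^2)$, where $L_n^\alpha(x)=\binom{n+\alpha}{n}\,{}_1F_1(-n;\alpha+1;x)$ are the Laguerre polynomials. Their Mellin transforms are, for $\operatorname{Re}s>0$, $$M_n^\mu(s)=\int_0^\infty x^{s-1}H_n^\mu(x)x^\mu e^{-x^2/2}\,dx.$$ $(a)_n=a(a+1)\cdots(a+n-1)$ is the Pochhammer symbol, and ${}_2F_1(-n,b;c;z)=\sum_{j=0}^n \frac{(-n)_j(b)_j}{(c)_j}\frac{z^j}{j!}$.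
   Formalization: The even-index formula is stated under the added condition μ + Re s > 0; for -1/2 < μ < 0 and 0 < Re s ≤ -μ the integral defining M_{2n}^μ(s) diverges at 0, since H_{2n}^μ(0) ≠ 0. *)

theory Defs
  imports "HOL-Analysis.Analysis"
begin

definition hyp1F1 :: "real \<Rightarrow> real \<Rightarrow> real \<Rightarrow> real" where
  "hyp1F1 a c x = (\<Sum>j. pochhammer a j / pochhammer c j * x ^ j / fact j)"

(* 2F1(-n, b; c; z): the degree parameter is n, not -n. *)
definition hyp2F1_neg :: "nat \<Rightarrow> complex \<Rightarrow> complex \<Rightarrow> complex \<Rightarrow> complex" where
  "hyp2F1_neg n b c z =
     (\<Sum>j=0..n. pochhammer (- of_nat n) j * pochhammer b j / pochhammer c j * (z ^ j / fact j))"

definition laguerre :: "nat \<Rightarrow> real \<Rightarrow> real \<Rightarrow> real" where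
  "laguerre n \<alpha> x = ((of_nat n + \<alpha>) gchoose n) * hyp1F1 (- of_nat n) (\<alpha> + 1) x"

definition gen_hermite :: "real \<Rightarrow> nat \<Rightarrow> real \<Rightarrow> real" where
  "gen_hermite \<mu> m x =
     (let n = m div 2 in
      if even m
      then (- 1) ^ n * 2 ^ (2 * n) * fact n * laguerre n (\<mu> - 1 / 2) (x\<^sup>2)
      else (- 1) ^ n * 2 ^ (2 * n + 1) * fact n * x * laguerre n (\<mu> + 1 / 2) (x\<^sup>2))"

definition mellin_integrand :: "real \<Rightarrow> nat \<Rightarrow> complex \<Rightarrow> real \<Rightarrow> complex" where
  "mellin_integrand \<mu> m s x =
     of_real x powr (s - 1) * of_real (gen_hermite \<mu> m x * x powr \<mu> * exp (- x\<^sup>2 / 2))"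

(* Lebesgue integral; it takes the value 0 when the integrand is not absolutely integrable. *)
definition mellin_hermite :: "real \<Rightarrow> nat \<Rightarrow> complex \<Rightarrow> complex" where
  "mellin_hermite \<mu> m s = (LBINT x:{0<..}. mellin_integrand \<mu> m s x)"

end

theory Submission imports Defs begin

text \<open>The substitution \<open>t = x\<^sup>2 / 2\<close> turns the Gamma integral into the Mellin transform of the Gaussian,
  \<open>2 powr (w/2 - 1) * \<Gamma>(w/2)\<close> at \<open>w\<close>. The weighted Hermite function is a finite combination of
  Gaussians multiplied by \<open>x ^ (2*j)\<close>, each of which only shifts \<open>w\<close> to \<open>w + 2*j\<close>; the shifts
  produce \<open>2 ^ j * pochhammer (w/2) j\<close>, that is, the terms of the terminating hypergeometric sum.\<close>

lemma has_bochner_integral_gaussian_mellin: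
  fixes w :: complex
  assumes "Re w > 0"
  shows "has_bochner_integral lborel
           (\<lambda>x. indicator {0<..} x *\<^sub>R (of_real x powr (w - 1) * of_real (exp (- x\<^sup>2 / 2))))
           (2 powr (w / 2 - 1) * Gamma (w / 2))"
proof -
  let ?f = "\<lambda>t. complex_of_real t powr (w / 2 - 1) / of_real (exp t)"
  let ?g = "\<lambda>x::real. x\<^sup>2 / 2"
  let ?h = "\<lambda>x. complex_of_real x powr (w - 1) * of_real (exp (- x\<^sup>2 / 2))"
  have S: "{0<..} \<in> sets (lebesgue :: real measure)"
    by simp
  have deriv: "(?g has_field_derivative x) (at x within {0<..})" for x
    by (auto intro!: derivative_eq_intros)
  have inj: "inj_on ?g {0<..}"
    by (auto simp: inj_on_def)
  have image: "?g ` {0<..} = {0<..}"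
  proof (intro equalityI subsetI)
    fix t :: real assume "t \<in> {0<..}"
    then show "t \<in> ?g ` {0<..}"
      by (intro image_eqI[of _ _ "sqrt (2 * t)"]) auto
  qed auto
  have pos: "Re (w / 2) > 0"
    using assms by simp
  \<comment> \<open>\<open>\<bar>x\<bar>\<close> is the absolute value of the derivative of
    \<open>?g\<close>. One change of variables carries both integrability and value over from the
    Gamma integral in \<open>t\<close>.\<close>
  have int: "(\<lambda>x. \<bar>x\<bar> *\<^sub>R ?f (?g x)) absolutely_integrable_on {0<..}"
    and val: "integral {0<..} (\<lambda>x. \<bar>x\<bar> *\<^sub>R ?f (?g x)) = Gamma (w / 2)"
    using has_absolute_integral_change_of_variables_real[OF S deriv inj, of ?f "Gamma (w / 2)"]
      absolutely_integrable_Gamma_integral'[OF pos] Gamma_integral_complex'[OF pos]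
    unfolding image by (blast intro: integral_unique)+
  have "has_bochner_integral lebesgue (\<lambda>x. indicator {0<..} x *\<^sub>R (\<bar>x\<bar> *\<^sub>R ?f (?g x))) (Gamma (w / 2))"
    using int val set_lebesgue_integral_eq_integral(2)[OF int]
    unfolding has_bochner_integral_iff set_integrable_def set_lebesgue_integral_def by argo
  \<comment> \<open>The constant cancels the power of 1/2 that comes out of \<open>?g x\<close>
    raised to \<open>w / 2 - 1\<close>.\<close>
  then have "has_bochner_integral lebesgue
      (\<lambda>x. 2 powr (w / 2 - 1) * (indicator {0<..} x *\<^sub>R (\<bar>x\<bar> *\<^sub>R ?f (?g x))))
      (2 powr (w / 2 - 1) * Gamma (w / 2))"
    by (intro has_bochner_integral_mult_right) auto
  also have "(\<lambda>x. 2 powr (w / 2 - 1) * (indicator {0<..} x *\<^sub>R (\<bar>x\<bar> *\<^sub>R ?f (?g x))))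
      = (\<lambda>x. indicator {0<..} x *\<^sub>R ?h x)"
  proof
    fix x :: real
    show "2 powr (w / 2 - 1) * (indicator {0<..} x *\<^sub>R (\<bar>x\<bar> *\<^sub>R ?f (?g x)))
        = indicator {0<..} x *\<^sub>R ?h x"
    proof (cases "x > 0")
      case True
      \<comment> \<open>Principal complex powers do not distribute over products in general; here
        all bases are nonnegative reals, where they do.\<close>
      have "2 powr (w / 2 - 1) * of_real (?g x) powr (w / 2 - 1) = complex_of_real (x * x) powr (w / 2 - 1)"
        using powr_times_real[of "2 :: complex" "of_real (?g x)" "w / 2 - 1"]
        by (simp add: power2_eq_square)
      also have "\<dots> = of_real x powr (w / 2 - 1) * of_real x powr (w / 2 - 1)"
        using True powr_times_real[of "of_real x" "of_real x" "w / 2 - 1"] by simp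
      also have "\<dots> = of_real x powr (w - 1 - 1)"
        by (simp flip: powr_add)
      also have "\<dots> = of_real x powr (w - 1) / of_real x"
        using True by (subst powr_diff) simp
      finally have "2 powr (w / 2 - 1) * of_real x * of_real (?g x) powr (w / 2 - 1)
          = of_real x powr (w - 1)"
        using True by (simp add: field_simps)
      then show ?thesis
        using True by (simp add: scaleR_conv_of_real exp_minus field_simps)
    qed simp
  qed
  finally have "has_bochner_integral lebesgue (\<lambda>x. indicator {0<..} x *\<^sub>R ?h x)
      (2 powr (w / 2 - 1) * Gamma (w / 2))" .
  \<comment> \<open>The change of variables lives on the completed measure \<open>lebesgue\<close>.
    Borel measurability of the integrand, from continuity on the open half-line, is what allows the
    descent to \<open>lborel\<close>.\<close>
  moreover have "(\<lambda>x. indicator {0<..} x *\<^sub>R ?h x) \<in> borel_measurable borel"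
    by (intro borel_measurable_continuous_on_indicator) (auto intro!: continuous_intros)
  ultimately show ?thesis
    by (simp only: has_bochner_integral_iff integrable_completion integral_completion measurable_lborel2)
qed

lemma hyp1F1_neg:
  "hyp1F1 (- of_nat n) c x = (\<Sum>j\<le>n. pochhammer (- of_nat n) j / pochhammer c j * x ^ j / fact j)"
  unfolding hyp1F1_def
  by (intro suminf_finite) (auto simp: pochhammer_of_nat_eq_0_lemma)

text \<open>The \<open>fact n\<close> in the Hermite normalization cancels the denominator of the
  binomial coefficient, leaving the Pochhammer symbol of the final formula.\<close>

lemma fact_mult_laguerre:
  "fact n * laguerre n \<alpha> x =
     (\<Sum>j\<le>n. pochhammer (\<alpha> + 1) n * (pochhammer (- of_nat n) j / pochhammer (\<alpha> + 1) j / fact j) * x ^ j)"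
  by (simp add: laguerre_def hyp1F1_neg gbinomial_pochhammer' sum_distrib_left mult_ac add_ac)

text \<open>Keeping \<open>w\<close> and \<alpha> independent lets both parities be instances:
  \<open>w\<close> = \<mu> + s with \<alpha> = \<mu> - 1/2, and \<open>w\<close> = \<mu> + s + 1
  with \<alpha> = \<mu> + 1/2.\<close>

lemma has_bochner_integral_laguerre_mellin:
  fixes w :: complex
  assumes "Re w > 0"
  shows "has_bochner_integral lborel
           (\<lambda>x. indicator {0<..} x *\<^sub>R
              (of_real x powr (w - 1) * of_real (fact n * laguerre n \<alpha> (x\<^sup>2) * exp (- x\<^sup>2 / 2))))
           (of_real (pochhammer (\<alpha> + 1) n) * 2 powr (w / 2 - 1) * Gamma (w / 2)
             * hyp2F1_neg n (w / 2) (of_real (\<alpha> + 1)) 2)"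
proof -
  define c where "c j = pochhammer (\<alpha> + 1) n * (pochhammer (- of_nat n) j / pochhammer (\<alpha> + 1) j / fact j)" for j
  let ?h = "\<lambda>w x. indicator {0<..} x *\<^sub>R (complex_of_real x powr (w - 1) * of_real (exp (- x\<^sup>2 / 2)))"
  let ?I = "\<lambda>w. 2 powr (w / 2 - 1) * Gamma (w / 2) :: complex"
  have "has_bochner_integral lborel (\<lambda>x. \<Sum>j\<le>n. of_real (c j) * ?h (w + 2 * of_nat j) x)
      (\<Sum>j\<le>n. of_real (c j) * ?I (w + 2 * of_nat j))"
    using assms
    by (intro has_bochner_integral_sum has_bochner_integral_mult_right
        has_bochner_integral_gaussian_mellin) simp
  also have "(\<lambda>x. \<Sum>j\<le>n. of_real (c j) * ?h (w + 2 * of_nat j) x) =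
      (\<lambda>x. indicator {0<..} x *\<^sub>R
        (of_real x powr (w - 1) * of_real (fact n * laguerre n \<alpha> (x\<^sup>2) * exp (- x\<^sup>2 / 2))))"
  proof
    fix x :: real
    have shift: "complex_of_real x powr (w + 2 * of_nat j - 1)
        = of_real x powr (w - 1) * of_real ((x\<^sup>2) ^ j)" if "x > 0" for j
    proof -
      have "complex_of_real x powr (w + 2 * of_nat j - 1)
          = of_real x powr (w - 1) * of_real x powr of_nat (2 * j)"
        by (simp add: algebra_simps flip: powr_add)
      also have "complex_of_real x powr of_nat (2 * j) = of_real ((x\<^sup>2) ^ j)"
        using that by (subst powr_nat') (simp_all add: power_mult)
      finally show ?thesis .
    qed
    have expansion: "fact n * laguerre n \<alpha> (x\<^sup>2) = (\<Sum>j\<le>n. c j * (x\<^sup>2) ^ j)"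
      unfolding c_def by (rule fact_mult_laguerre)
    show "(\<Sum>j\<le>n. of_real (c j) * ?h (w + 2 * of_nat j) x) = indicator {0<..} x *\<^sub>R
        (of_real x powr (w - 1) * of_real (fact n * laguerre n \<alpha> (x\<^sup>2) * exp (- x\<^sup>2 / 2)))"
    proof (cases "x > 0")
      case True
      then show ?thesis
        unfolding expansion
        by (simp add: shift) (simp add: sum_distrib_left sum_distrib_right mult_ac)
    qed simp
  qed
  also have "(\<Sum>j\<le>n. of_real (c j) * ?I (w + 2 * of_nat j)) =
      of_real (pochhammer (\<alpha> + 1) n) * 2 powr (w / 2 - 1) * Gamma (w / 2)
        * hyp2F1_neg n (w / 2) (of_real (\<alpha> + 1)) 2"
  proof -
    \<comment> \<open>Away from the poles \<open>pochhammer\<close> is a quotient of Gamma values,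
      and the denominator \<open>Gamma (w / 2)\<close> is nonzero, so it can be cleared.\<close>
    have "w / 2 \<notin> \<int>\<^sub>\<le>\<^sub>0"
      using assms by (auto elim!: nonpos_Ints_cases simp: complex_eq_iff)
    then have Gamma_shift: "Gamma (w / 2 + of_nat j) = pochhammer (w / 2) j * Gamma (w / 2)" for j
      by (simp add: pochhammer_Gamma Gamma_eq_zero_iff)
    have "2 powr (w / 2 + of_nat j - 1) = 2 powr (w / 2 - 1) * (2 ^ j :: complex)" for j
    proof -
      have "2 powr (w / 2 + of_nat j - 1) = (2 :: complex) powr (w / 2 - 1 + of_nat j)"
        by (simp add: algebra_simps)
      then show ?thesis
        by (simp only: powr_add) (simp add: powr_nat')
    qed
    \<comment> \<open>This \<open>2 ^ j\<close> is the power of the argument 2 in the hypergeometric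
      sum.\<close>
    then have I: "?I (w + 2 * of_nat j) = ?I w * (2 ^ j * pochhammer (w / 2) j)" for j
      by (simp add: add_divide_distrib Gamma_shift mult_ac)
    have "of_real (c j) = complex_of_real (pochhammer (\<alpha> + 1) n) *
        (pochhammer (- of_nat n) j / pochhammer (of_real (\<alpha> + 1)) j / fact j)" for j
      unfolding c_def by (simp flip: pochhammer_of_real)
    then show ?thesis
      by (simp only: I) (simp add: hyp2F1_neg_def sum_distrib_left atMost_atLeast0 mult_ac)
  qed
  finally show ?thesis .
qed

text \<open>Near 0 the even integrand has modulus of order x to the power \<mu> + Re s - 1, since
  the even polynomials do not vanish at 0. For negative \<mu> this may fail to be integrable
  although Re s > 0, hence the guard. The odd polynomials supply a factor x, which raises the
  exponent to \<mu> + Re s > -1/2. Integrability is asserted separately because the default value 0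
  of the integral would hide divergence.\<close>

theorem proposition1:
  fixes \<mu> :: real and n :: nat and s :: complex
  assumes "\<mu> > - 1 / 2" and "Re s > 0"
  shows "(\<mu> + Re s > 0 \<longrightarrow>
           set_integrable lborel {0<..} (mellin_integrand \<mu> (2 * n) s) \<and>
           mellin_hermite \<mu> (2 * n) s =
             (- 1) ^ n * 2 ^ (2 * n) * 2 powr ((of_real \<mu> + s) / 2 - 1)
             * of_real (pochhammer (\<mu> + 1 / 2) n) * Gamma ((of_real \<mu> + s) / 2)
             * hyp2F1_neg n ((of_real \<mu> + s) / 2) (of_real (\<mu> + 1 / 2)) 2) \<and>
         set_integrable lborel {0<..} (mellin_integrand \<mu> (2 * n + 1) s) \<and>
         mellin_hermite \<mu> (2 * n + 1) s =
             (- 1) ^ n * 2 ^ (2 * n) * 2 powr ((of_real \<mu> + s + 1) / 2)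
             * of_real (pochhammer (\<mu> + 3 / 2) n) * Gamma ((of_real \<mu> + s + 1) / 2)
             * hyp2F1_neg n ((of_real \<mu> + s + 1) / 2) (of_real (\<mu> + 3 / 2)) 2"
proof -
  \<comment> \<open>Agreement for positive \<open>x\<close> is enough because the indicator kills
    the rest. The separate \<open>J'\<close> leaves matching the closed forms as a purely algebraic
    goal.\<close>
  have integral_eq: "set_integrable lborel {0<..} (mellin_integrand \<mu> m s) \<and> mellin_hermite \<mu> m s = J'"
    if "has_bochner_integral lborel (\<lambda>x. a * (indicator {0<..} x *\<^sub>R
          (of_real x powr (w - 1) * of_real (fact n * laguerre n \<alpha> (x\<^sup>2) * exp (- x\<^sup>2 / 2))))) J"
      and "\<And>x. x > 0 \<Longrightarrow> mellin_integrand \<mu> m s x =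
        a * (of_real x powr (w - 1) * of_real (fact n * laguerre n \<alpha> (x\<^sup>2) * exp (- x\<^sup>2 / 2)))"
      and "J = J'"
    for m a w \<alpha> J J'
  proof -
    have "(\<lambda>x. a * (indicator {0<..} x *\<^sub>R
          (of_real x powr (w - 1) * of_real (fact n * laguerre n \<alpha> (x\<^sup>2) * exp (- x\<^sup>2 / 2)))))
        = (\<lambda>x. indicator {0<..} x *\<^sub>R mellin_integrand \<mu> m s x)"
      by (intro ext) (metis greaterThan_iff indicator_simps(2) mult_zero_right scaleR_one
          indicator_simps(1) scaleR_zero_left that(2))
    then show ?thesis
      using that(1,3) by (simp add: has_bochner_integral_iff set_integrable_def
          mellin_hermite_def set_lebesgue_integral_def)
  qed
  have weight: "complex_of_real x powr (s - 1) * of_real (x powr \<mu>) = of_real x powr (of_real \<mu> + s - 1)"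
    if "x > 0" for x
    using that by (simp add: algebra_simps flip: powr_of_real powr_add)
  have weight_odd: "complex_of_real x powr (s - 1) * (of_real x * of_real (x powr \<mu>))
      = of_real x powr (of_real \<mu> + s)" if "x > 0" for x
  proof -
    have "complex_of_real x powr (of_real \<mu> + s)
        = of_real x powr (of_real \<mu> + s - 1) * of_real x powr 1"
      using that by (simp add: powr_diff)
    then show ?thesis
      using that by (simp flip: weight)
  qed
  have even: "set_integrable lborel {0<..} (mellin_integrand \<mu> (2 * n) s) \<and>
      mellin_hermite \<mu> (2 * n) s = (- 1) ^ n * 2 ^ (2 * n) * 2 powr ((of_real \<mu> + s) / 2 - 1)
        * of_real (pochhammer (\<mu> + 1 / 2) n) * Gamma ((of_real \<mu> + s) / 2)
        * hyp2F1_neg n ((of_real \<mu> + s) / 2) (of_real (\<mu> + 1 / 2)) 2"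
    if "\<mu> + Re s > 0"
  proof (rule integral_eq[OF has_bochner_integral_mult_right[OF
          has_bochner_integral_laguerre_mellin[of "of_real \<mu> + s" n "\<mu> - 1 / 2"]]])
    show "mellin_integrand \<mu> (2 * n) s x = (- 1) ^ n * 2 ^ (2 * n) *
        (of_real x powr (of_real \<mu> + s - 1) *
         of_real (fact n * laguerre n (\<mu> - 1 / 2) (x\<^sup>2) * exp (- x\<^sup>2 / 2)))" if "x > 0" for x
      using that by (simp add: mellin_integrand_def gen_hermite_def mult_ac flip: weight)
  qed (use that in \<open>simp_all add: mult_ac add.commute\<close>)
  have odd: "set_integrable lborel {0<..} (mellin_integrand \<mu> (2 * n + 1) s) \<and>
      mellin_hermite \<mu> (2 * n + 1) s = (- 1) ^ n * 2 ^ (2 * n) * 2 powr ((of_real \<mu> + s + 1) / 2)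
        * of_real (pochhammer (\<mu> + 3 / 2) n) * Gamma ((of_real \<mu> + s + 1) / 2)
        * hyp2F1_neg n ((of_real \<mu> + s + 1) / 2) (of_real (\<mu> + 3 / 2)) 2"
  proof (rule integral_eq[OF has_bochner_integral_mult_right[OF
          has_bochner_integral_laguerre_mellin[of "of_real \<mu> + s + 1" n "\<mu> + 1 / 2"]]])
    show "mellin_integrand \<mu> (2 * n + 1) s x = (- 1) ^ n * 2 ^ (2 * n + 1) *
        (of_real x powr (of_real \<mu> + s + 1 - 1) *
         of_real (fact n * laguerre n (\<mu> + 1 / 2) (x\<^sup>2) * exp (- x\<^sup>2 / 2)))" if "x > 0" for x
      using that by (simp add: mellin_integrand_def gen_hermite_def mult_ac flip: weight_odd)
    \<comment> \<open>The odd normalization has one more factor 2 than the even one; it is absorbed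
      here by raising the exponent of \<open>2 powr\<close> by one.\<close>
    have "2 powr ((of_real \<mu> + s + 1) / 2) = 2 * 2 powr ((of_real \<mu> + s + 1) / 2 - 1)"
      by (simp add: powr_diff)
    moreover have "\<mu> + 1 / 2 + 1 = \<mu> + 3 / 2"
      by simp
    ultimately show "(- 1) ^ n * 2 ^ (2 * n + 1) *
        (of_real (pochhammer (\<mu> + 1 / 2 + 1) n) * 2 powr ((of_real \<mu> + s + 1) / 2 - 1) *
          Gamma ((of_real \<mu> + s + 1) / 2) *
          hyp2F1_neg n ((of_real \<mu> + s + 1) / 2) (of_real (\<mu> + 1 / 2 + 1)) 2) =
        (- 1) ^ n * 2 ^ (2 * n) * 2 powr ((of_real \<mu> + s + 1) / 2)
        * of_real (pochhammer (\<mu> + 3 / 2) n) * Gamma ((of_real \<mu> + s + 1) / 2)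
        * hyp2F1_neg n ((of_real \<mu> + s + 1) / 2) (of_real (\<mu> + 3 / 2)) 2"
      by (simp only: power_add power_one_right mult_ac)
  qed (use assms in simp_all)
  show ?thesis
    using even odd by blast
qed

end
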